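(* Let $G$ be a group, let $\partial:M\to L$ be a $G$-equivariant crossed module, $Q=\mathrm{Coker}(\partial)$, and let $P$ be an $(M\xrightarrow{\partial}L)$-bitorsor. Then $\pi_*(P)\in H^0(G,Q)$.
   Context: Groups are written multiplicatively. A crossed module $\partial:M\to L$ is a group homomorphism with an action $(\tau,m)\mapsto{}^\tau m$ of $L$ on $M$ by automorphisms such that $\partial({}^\tau m)=\tau\partial(m)\tau^{-1}$ and ${}^{\partial(n)}m=nmn^{-1}$. It is $G$-equivariant if $G$ acts on $M$ and $L$ by group automorphisms with $\partial({}^xm)={}^x\partial(m)$ and ${}^x({}^\tau m)={}^{({}^x\tau)}({}^xm)$. Then $Q=L/\partial(M)$ inherits a $G$-action; $\pi:L\to Q$ is the quotient map; $H^0(G,Q)$ is the set of $G$-fixed elements of $Q$. A right $M$-torsor is a nonempty set $P$ with a right action of $M$ and a left action of $G$ such that ${}^x(pm)={}^xp\,{}^xm$, and such that for all $p,q\in P$ there is a unique $m\in M$ with $q=pm$. An $(M\xrightarrow{\partial}L)$-bitorsor is a pair $(P,\alpha)$ with $P$ a right $M$-torsor and $\alpha:P\to L$ a function with $\alpha({}^xp)={}^x\alpha(p)$ for $x\in G$ and $\alpha(pm)=\alpha(p)\partial(m)$ for $m\in M$. With $\xi(p)=\alpha(p)^{-1}$, one sets $\pi_*(P):=\pi(\xi(p))\in Q$, which is independent of the choice of $p\in P$. *)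

theory Defs
  imports "HOL-Algebra.Algebra"
begin

text \<open>
  An action by group automorphisms is a homomorphism into \<^const>\<open>AutoGroup\<close>, and an action on a
  set a homomorphism into \<^const>\<open>BijGroup\<close> (\<^const>\<open>group_action\<close>). Both are left actions,
  since multiplication in these groups is composition of functions.
\<close>

locale crossed_module = group_hom M L d
  for M :: "('m, 'c) monoid_scheme" and L :: "('l, 'd) monoid_scheme"
    and actLM :: "'l \<Rightarrow> 'm \<Rightarrow> 'm" and d :: "'m \<Rightarrow> 'l" +
  assumes actLM_hom: "group_hom L (AutoGroup M) actLM"
    and d_actLM: "\<lbrakk>t \<in> carrier L; m \<in> carrier M\<rbrakk>
      \<Longrightarrow> d (actLM t m) = t \<otimes>\<^bsub>L\<^esub> d m \<otimes>\<^bsub>L\<^esub> inv\<^bsub>L\<^esub> t"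
    and peiffer: "\<lbrakk>n \<in> carrier M; m \<in> carrier M\<rbrakk>
      \<Longrightarrow> actLM (d n) m = n \<otimes>\<^bsub>M\<^esub> m \<otimes>\<^bsub>M\<^esub> inv\<^bsub>M\<^esub> n"

locale equivariant_crossed_module = crossed_module M L actLM d
  for G :: "('g, 'b) monoid_scheme"
    and M :: "('m, 'c) monoid_scheme" and L :: "('l, 'd) monoid_scheme"
    and actLM :: "'l \<Rightarrow> 'm \<Rightarrow> 'm" and d :: "'m \<Rightarrow> 'l"
    and actGM :: "'g \<Rightarrow> 'm \<Rightarrow> 'm" and actGL :: "'g \<Rightarrow> 'l \<Rightarrow> 'l" +
  assumes actGM_hom: "group_hom G (AutoGroup M) actGM"
    and actGL_hom: "group_hom G (AutoGroup L) actGL"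
    and d_equivariant: "\<lbrakk>x \<in> carrier G; m \<in> carrier M\<rbrakk> \<Longrightarrow> d (actGM x m) = actGL x (d m)"
    and act_equivariant: "\<lbrakk>x \<in> carrier G; t \<in> carrier L; m \<in> carrier M\<rbrakk>
      \<Longrightarrow> actGM x (actLM t m) = actLM (actGL x t) (actGM x m)"

definition coker :: "('m, 'c) monoid_scheme \<Rightarrow> ('l, 'd) monoid_scheme \<Rightarrow> ('m \<Rightarrow> 'l) \<Rightarrow> 'l set monoid"
  where "coker M L d = L Mod (d ` carrier M)"

definition coker_proj ::
    "('m, 'c) monoid_scheme \<Rightarrow> ('l, 'd) monoid_scheme \<Rightarrow> ('m \<Rightarrow> 'l) \<Rightarrow> 'l \<Rightarrow> 'l set"
  where "coker_proj M L d l = (d ` carrier M) #>\<^bsub>L\<^esub> l"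

text \<open>
  The image of a coset under an element of \<open>G\<close> is again a coset; this is the action induced on
  the quotient, see \<open>coker_act_proj\<close> and \<open>coker_act_hom\<close> below.
\<close>

definition coker_act ::
    "('m, 'c) monoid_scheme \<Rightarrow> ('l, 'd) monoid_scheme \<Rightarrow> ('m \<Rightarrow> 'l) \<Rightarrow> ('g \<Rightarrow> 'l \<Rightarrow> 'l)
      \<Rightarrow> 'g \<Rightarrow> 'l set \<Rightarrow> 'l set"
  where "coker_act M L d actGL x = (\<lambda>C \<in> carrier (coker M L d). actGL x ` C)"

definition H0 ::
    "('g, 'b) monoid_scheme \<Rightarrow> ('q, 'c) monoid_scheme \<Rightarrow> ('g \<Rightarrow> 'q \<Rightarrow> 'q) \<Rightarrow> 'q set"
  where "H0 G Q actGQ = {q \<in> carrier Q. \<forall>x \<in> carrier G. actGQ x q = q}"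

locale right_torsor = M: group M + P: group_action G P actGP
  for G :: "('g, 'b) monoid_scheme" and M :: "('m, 'c) monoid_scheme"
    and actGM :: "'g \<Rightarrow> 'm \<Rightarrow> 'm"
    and P :: "'p set" and actGP :: "'g \<Rightarrow> 'p \<Rightarrow> 'p" and ract :: "'p \<Rightarrow> 'm \<Rightarrow> 'p" +
  assumes nonempty: "P \<noteq> {}"
    and ract_closed: "\<lbrakk>p \<in> P; m \<in> carrier M\<rbrakk> \<Longrightarrow> ract p m \<in> P"
    and ract_one: "p \<in> P \<Longrightarrow> ract p \<one>\<^bsub>M\<^esub> = p"
    and ract_mult: "\<lbrakk>p \<in> P; m \<in> carrier M; n \<in> carrier M\<rbrakk>
      \<Longrightarrow> ract p (m \<otimes>\<^bsub>M\<^esub> n) = ract (ract p m) n"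
    and actGP_ract: "\<lbrakk>x \<in> carrier G; p \<in> P; m \<in> carrier M\<rbrakk>
      \<Longrightarrow> actGP x (ract p m) = ract (actGP x p) (actGM x m)"
    and simply_transitive: "\<lbrakk>p \<in> P; q \<in> P\<rbrakk> \<Longrightarrow> \<exists>!m. m \<in> carrier M \<and> q = ract p m"

locale bitorsor = right_torsor G M actGM P actGP ract
  for G :: "('g, 'b) monoid_scheme"
    and M :: "('m, 'c) monoid_scheme" and L :: "('l, 'd) monoid_scheme" and d :: "'m \<Rightarrow> 'l"
    and actGM :: "'g \<Rightarrow> 'm \<Rightarrow> 'm" and actGL :: "'g \<Rightarrow> 'l \<Rightarrow> 'l"
    and P :: "'p set" and actGP :: "'g \<Rightarrow> 'p \<Rightarrow> 'p" and ract :: "'p \<Rightarrow> 'm \<Rightarrow> 'p"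
    and \<alpha> :: "'p \<Rightarrow> 'l" +
  assumes \<alpha>_closed: "\<alpha> \<in> P \<rightarrow> carrier L"
    and \<alpha>_equivariant: "\<lbrakk>x \<in> carrier G; p \<in> P\<rbrakk> \<Longrightarrow> \<alpha> (actGP x p) = actGL x (\<alpha> p)"
    and \<alpha>_ract: "\<lbrakk>p \<in> P; m \<in> carrier M\<rbrakk> \<Longrightarrow> \<alpha> (ract p m) = \<alpha> p \<otimes>\<^bsub>L\<^esub> d m"

text \<open>The value does not depend on the chosen point, see \<open>pi_star_eq\<close> below.\<close>

definition pi_star ::
    "('m, 'c) monoid_scheme \<Rightarrow> ('l, 'd) monoid_scheme \<Rightarrow> ('m \<Rightarrow> 'l) \<Rightarrow> 'p set \<Rightarrow> ('p \<Rightarrow> 'l) \<Rightarrow> 'l set"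
  where "pi_star M L d P \<alpha> = coker_proj M L d (inv\<^bsub>L\<^esub> (\<alpha> (SOME p. p \<in> P)))"

context crossed_module
begin

lemma image_normal: "d ` carrier M \<lhd> L"
proof (rule H.normal_invI)
  show "subgroup (d ` carrier M) L"
    by (rule img_is_subgroup)
next
  fix t h
  assume t: "t \<in> carrier L" and "h \<in> d ` carrier M"
  then obtain m where m: "m \<in> carrier M" and h: "h = d m" by blast
  have "actLM t \<in> carrier (AutoGroup M)"
    using group_hom.hom_closed[OF actLM_hom t] .
  then have "actLM t m \<in> carrier M"
    using m by (auto simp: AutoGroup_def auto_def hom_def)
  then show "t \<otimes>\<^bsub>L\<^esub> h \<otimes>\<^bsub>L\<^esub> inv\<^bsub>L\<^esub> t \<in> d ` carrier M"
    using d_actLM[OF t m] h by (metis imageI)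
qed

lemma coker_group: "group (coker M L d)"
  unfolding coker_def by (rule normal.factorgroup_is_group[OF image_normal])

lemma coker_proj_hom: "coker_proj M L d \<in> hom L (coker M L d)"
  using normal.r_coset_hom_Mod[OF image_normal] by (simp add: coker_def coker_proj_def [abs_def])

lemma carrier_coker: "carrier (coker M L d) = coker_proj M L d ` carrier L"
  by (simp add: coker_def coker_proj_def [abs_def] carrier_FactGroup)

end

context equivariant_crossed_module
begin

lemma actGL_auto:
  assumes "x \<in> carrier G"
  shows "actGL x \<in> hom L L" "bij_betw (actGL x) (carrier L) (carrier L)"
  using group_hom.hom_closed[OF actGL_hom assms] by (auto simp: AutoGroup_def auto_def Bij_def)

lemma actGL_image:
  assumes x: "x \<in> carrier G"
  shows "actGL x ` d ` carrier M = d ` carrier M"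
proof -
  have "bij_betw (actGM x) (carrier M) (carrier M)"
    using group_hom.hom_closed[OF actGM_hom x] by (auto simp: AutoGroup_def auto_def Bij_def)
  then have "d ` carrier M = (\<lambda>m. d (actGM x m)) ` carrier M"
    by (metis bij_betw_imp_surj_on image_image)
  also have "\<dots> = actGL x ` d ` carrier M"
    using d_equivariant[OF x] by (simp add: image_image)
  finally show ?thesis by simp
qed

lemma coker_act_proj:
  assumes x: "x \<in> carrier G" and l: "l \<in> carrier L"
  shows "coker_act M L d actGL x (coker_proj M L d l) = coker_proj M L d (actGL x l)"
proof -
  have "actGL x ` coker_proj M L d l = (\<lambda>h. actGL x (h \<otimes>\<^bsub>L\<^esub> l)) ` d ` carrier M"
    by (auto simp: coker_proj_def r_coset_def)
  also have "\<dots> = (\<lambda>h. actGL x h \<otimes>\<^bsub>L\<^esub> actGL x l) ` d ` carrier M"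
    by (rule image_cong) (use actGL_auto(1)[OF x] l in \<open>auto simp: hom_def\<close>)
  also have "\<dots> = (\<lambda>h. h \<otimes>\<^bsub>L\<^esub> actGL x l) ` actGL x ` d ` carrier M"
    by (simp add: image_image)
  also have "\<dots> = coker_proj M L d (actGL x l)"
    unfolding actGL_image[OF x] by (auto simp: coker_proj_def r_coset_def)
  finally show ?thesis
    using l by (simp add: coker_act_def carrier_coker)
qed

lemma coker_act_hom: "group_hom G (AutoGroup (coker M L d)) (coker_act M L d actGL)"
proof -
  let ?Q = "coker M L d" and ?a = "coker_act M L d actGL" and ?p = "coker_proj M L d"
  have G: "group G" using actGL_hom by (simp add: group_hom_def)
  have comp: "actGL (x \<otimes>\<^bsub>G\<^esub> y) l = actGL x (actGL y l)"
    if "x \<in> carrier G" "y \<in> carrier G" "l \<in> carrier L" for x y l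
  proof -
    have "actGL x \<in> auto L" "actGL y \<in> auto L"
      using that group_hom.hom_closed[OF actGL_hom] by (auto simp: AutoGroup_def)
    then show ?thesis
      using group_hom.hom_mult[OF actGL_hom that(1,2)] that(3)
      by (simp add: AutoGroup_def BijGroup_def auto_def compose_def)
  qed
  have closed: "actGL x l \<in> carrier L" if "x \<in> carrier G" "l \<in> carrier L" for x l
    using actGL_auto(1)[OF that(1)] that(2) by (auto simp: hom_def)
  have one: "actGL \<one>\<^bsub>G\<^esub> l = l" if "l \<in> carrier L" for l
    using group_hom.hom_one[OF actGL_hom] that by (simp add: AutoGroup_def BijGroup_def)
  have a_comp: "?a (x \<otimes>\<^bsub>G\<^esub> y) C = ?a x (?a y C)"
    if "x \<in> carrier G" "y \<in> carrier G" "C \<in> carrier ?Q" for x y C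
    using that G by (auto simp: carrier_coker coker_act_proj closed comp group.is_monoid
        monoid.m_closed)
  have a_one: "?a \<one>\<^bsub>G\<^esub> C = C" if "C \<in> carrier ?Q" for C
    using that G by (auto simp: carrier_coker coker_act_proj one group.is_monoid
        monoid.one_closed)
  have a_closed: "?a x C \<in> carrier ?Q" if "x \<in> carrier G" "C \<in> carrier ?Q" for x C
    using that by (auto simp: carrier_coker coker_act_proj closed)
  have a_mult: "?a x (C \<otimes>\<^bsub>?Q\<^esub> D) = ?a x C \<otimes>\<^bsub>?Q\<^esub> ?a x D"
    if x: "x \<in> carrier G" and CD: "C \<in> carrier ?Q" "D \<in> carrier ?Q" for x C D
  proof -
    obtain k l where kl: "k \<in> carrier L" "l \<in> carrier L" "C = ?p k" "D = ?p l"
      using CD by (auto simp: carrier_coker)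
    then show ?thesis
      using x by (simp add: coker_act_proj closed Group.hom_mult[OF actGL_auto(1)[OF x]]
          flip: Group.hom_mult[OF coker_proj_hom])
  qed
  have a_bij: "bij_betw (?a x) (carrier ?Q) (carrier ?Q)" if x: "x \<in> carrier G" for x
  proof (rule bij_betw_byWitness[where f' = "?a (inv\<^bsub>G\<^esub> x)"])
    note ix = group.inv_closed[OF G x]
    show "\<forall>C\<in>carrier ?Q. ?a (inv\<^bsub>G\<^esub> x) (?a x C) = C"
      using a_comp[OF ix x] a_one by (simp add: group.l_inv[OF G x])
    show "\<forall>C\<in>carrier ?Q. ?a x (?a (inv\<^bsub>G\<^esub> x) C) = C"
      using a_comp[OF x ix] a_one by (simp add: group.r_inv[OF G x])
    show "?a x ` carrier ?Q \<subseteq> carrier ?Q" "?a (inv\<^bsub>G\<^esub> x) ` carrier ?Q \<subseteq> carrier ?Q"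
      using a_closed x ix by auto
  qed
  have a_auto: "?a x \<in> auto ?Q" if "x \<in> carrier G" for x
    using that a_closed a_mult a_bij
    by (auto simp: auto_def hom_def Bij_def coker_act_def)
  have "?a \<in> hom G (AutoGroup ?Q)"
  proof (rule homI)
    show "?a x \<in> carrier (AutoGroup ?Q)" if "x \<in> carrier G" for x
      using a_auto[OF that] by (simp add: AutoGroup_def)
    fix x y assume xy: "x \<in> carrier G" "y \<in> carrier G"
    have "?a (x \<otimes>\<^bsub>G\<^esub> y) = compose (carrier ?Q) (?a x) (?a y)"
    proof (rule extensionalityI)
      show "?a (x \<otimes>\<^bsub>G\<^esub> y) \<in> extensional (carrier ?Q)" by (simp add: coker_act_def)
    qed (simp_all add: compose_eq a_comp[OF xy])
    then show "?a (x \<otimes>\<^bsub>G\<^esub> y) = ?a x \<otimes>\<^bsub>AutoGroup ?Q\<^esub> ?a y"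
      using a_auto xy by (simp add: AutoGroup_def BijGroup_def auto_def)
  qed
  then show ?thesis
    using G group.AutoGroup[OF coker_group] by (simp add: group_hom_def group_hom_axioms_def)
qed

end

lemma pi_star_eq:
  assumes "crossed_module M L actLM d"
    and "bitorsor G M L d actGM actGL P actGP ract \<alpha>"
    and "p \<in> P"
  shows "pi_star M L d P \<alpha> = coker_proj M L d (inv\<^bsub>L\<^esub> (\<alpha> p))"
proof -
  interpret crossed_module M L actLM d by fact
  interpret T: bitorsor G M L d actGM actGL P actGP ract \<alpha> by fact
  define q where "q = (SOME p. p \<in> P)"
  have q: "q \<in> P" unfolding q_def using assms(3) by (rule someI)
  obtain m where m: "m \<in> carrier M" "q = ract p m"
    using T.simply_transitive[OF assms(3) q] by blast
  have a: "\<alpha> p \<in> carrier L" using T.\<alpha>_closed assms(3) by auto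
  have N: "subgroup (d ` carrier M) L" by (rule img_is_subgroup)
  have "inv\<^bsub>L\<^esub> (\<alpha> q) = inv\<^bsub>L\<^esub> (d m) \<otimes>\<^bsub>L\<^esub> inv\<^bsub>L\<^esub> (\<alpha> p)"
    using m a T.\<alpha>_ract[OF assms(3) m(1)] by (simp add: H.inv_mult_group)
  moreover have "inv\<^bsub>L\<^esub> (d m) \<in> d ` carrier M"
    using m(1) N by (simp add: subgroup.m_inv_closed)
  ultimately have "inv\<^bsub>L\<^esub> (\<alpha> q) \<in> d ` carrier M #>\<^bsub>L\<^esub> inv\<^bsub>L\<^esub> (\<alpha> p)"
    by (auto simp: r_coset_def)
  then have "d ` carrier M #>\<^bsub>L\<^esub> inv\<^bsub>L\<^esub> (\<alpha> p) = d ` carrier M #>\<^bsub>L\<^esub> inv\<^bsub>L\<^esub> (\<alpha> q)"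
    using a N by (intro H.repr_independence) auto
  then show ?thesis by (simp add: pi_star_def coker_proj_def q_def)
qed

end

theory Submission
  imports Defs
begin

text \<open>The class of \<open>\<alpha> p\<close> inverse modulo the image of \<open>d\<close> is
  the same for every point \<open>p\<close>, since two points differ by some \<open>m\<close> and
  their values under \<open>\<alpha>\<close> by the factor \<open>d m\<close>
  (\<open>pi_star_eq\<close>). The action of \<open>x\<close> on the cokernel is computed on
  representatives (\<open>coker_act_proj\<close>), so by equivariance of \<open>\<alpha>\<close> it
  turns the class read off at \<open>p\<close> into the class read off at the translate of
  \<open>p\<close> by \<open>x\<close>. These coincide.\<close>

theorem lemma26:
  fixes G :: "('g, 'b) monoid_scheme"
    and M :: "('m, 'c) monoid_scheme" and L :: "('l, 'd) monoid_scheme"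
    and actLM :: "'l \<Rightarrow> 'm \<Rightarrow> 'm" and d :: "'m \<Rightarrow> 'l"
    and actGM :: "'g \<Rightarrow> 'm \<Rightarrow> 'm" and actGL :: "'g \<Rightarrow> 'l \<Rightarrow> 'l"
    and P :: "'p set" and actGP :: "'g \<Rightarrow> 'p \<Rightarrow> 'p" and ract :: "'p \<Rightarrow> 'm \<Rightarrow> 'p"
    and \<alpha> :: "'p \<Rightarrow> 'l"
  assumes "equivariant_crossed_module G M L actLM d actGM actGL"
    and "bitorsor G M L d actGM actGL P actGP ract \<alpha>"
  shows "pi_star M L d P \<alpha> \<in> H0 G (coker M L d) (coker_act M L d actGL)"
proof -
  interpret equivariant_crossed_module G M L actLM d actGM actGL by fact
  interpret T: bitorsor G M L d actGM actGL P actGP ract \<alpha> by fact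
  \<comment> \<open>Kept general in \<open>p\<close>, as it serves at two points: a fixed
    \<open>p\<close> and its translate by \<open>x\<close>.\<close>
  have star: "pi_star M L d P \<alpha> = coker_proj M L d (inv\<^bsub>L\<^esub> (\<alpha> p))" if "p \<in> P" for p
    using crossed_module_axioms assms(2) that by (rule pi_star_eq)
  obtain p where p: "p \<in> P" using T.nonempty by blast
  have a: "\<alpha> p \<in> carrier L" using T.\<alpha>_closed p by auto
  have "coker_act M L d actGL x (pi_star M L d P \<alpha>) = pi_star M L d P \<alpha>"
    if x: "x \<in> carrier G" for x
  proof -
    \<comment> \<open>As a group endomorphism of \<open>L\<close>, \<open>actGL x\<close> commutes
      with inversion, so equivariance of \<open>\<alpha>\<close> passes to its pointwise
      inverse.\<close>
    interpret x: group_hom L L "actGL x"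
      using actGL_auto(1)[OF x] by unfold_locales
    have xp: "actGP x p \<in> P" using T.P.element_image[OF x p refl] .
    have "coker_act M L d actGL x (pi_star M L d P \<alpha>) = coker_proj M L d (actGL x (inv\<^bsub>L\<^esub> (\<alpha> p)))"
      using a by (simp add: star[OF p] coker_act_proj[OF x])
    also have "\<dots> = coker_proj M L d (inv\<^bsub>L\<^esub> (\<alpha> (actGP x p)))"
      using a by (simp add: T.\<alpha>_equivariant[OF x p])
    \<comment> \<open>Independence of the base point, now read at the translate of \<open>p\<close>,
      closes the circle.\<close>
    also have "\<dots> = pi_star M L d P \<alpha>"
      by (rule star[OF xp, symmetric])
    finally show ?thesis .
  qed
  moreover have "pi_star M L d P \<alpha> \<in> carrier (coker M L d)"
    using a by (simp add: star[OF p] carrier_coker)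
  ultimately show ?thesis by (simp add: H0_def)
qed

end
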